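(* Let $\alpha=(a_0({\bf x}),a_1({\bf x}),a_2({\bf x}),\ldots)$ be a Stieltjes moment sequence of polynomials in ${\bf x}=(x_1,\ldots,x_n)$ such that $\deg(a_k({\bf x}))=k$ for all $k\ge0$. Then $H_{x_0}(\alpha)=(H_{x_0}(a_0({\bf x})),H_{x_0}(a_1({\bf x})),\ldots)$ is a Stieltjes moment sequence of polynomials in the variables $x_0,x_1,\ldots,x_n$.
   Context: A polynomial is nonnegative (with respect to its variables) if all its coefficients are nonnegative. A matrix of polynomials is totally positive (with respect to its variables) if every minor of every finite order has nonnegative coefficients. A sequence $(a_k)_{k\ge0}$ of polynomials is a Stieltjes moment sequence of polynomials if its Hankel matrix $[a_{i+j}]_{i,j\ge0}$ is totally positive in this sense. The degree $\deg(a({\bf x}))$ of a nonzero polynomial is the maximum total degree $i_1+\cdots+i_n$ of its monomials $x_1^{i_1}\cdots x_n^{i_n}$ with nonzero coefficient. If $\deg(a({\bf x}))=d$, then $H_{x_0}(a({\bf x}))=x_0^{d}\,a(x_1/x_0,\ldots,x_n/x_0)$ (the homogenization with respect to a new variable $x_0$). *)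

theory Defs
  imports "HOL-Library.Poly_Mapping" "Jordan_Normal_Form.Determinant"
begin

text \<open>
  Multivariate polynomials with coefficients in a commutative ring, in the indeterminates
  x_0, x_1, x_2, ...: a monomial is a finitely supported exponent function on variable indices,
  and a polynomial is a finitely supported function from monomials to coefficients.  The ring
  structure is the one of \<^theory>\<open>HOL-Library.Poly_Mapping\<close>.
\<close>

type_synonym monomial = "nat \<Rightarrow>\<^sub>0 nat"
type_synonym 'a mpoly = "monomial \<Rightarrow>\<^sub>0 'a"

definition polys_in :: "nat set \<Rightarrow> 'a::zero mpoly set" where
  "polys_in V = {p. \<forall>m \<in> Poly_Mapping.keys p. Poly_Mapping.keys m \<subseteq> V}"

definition monom_degree :: "monomial \<Rightarrow> nat" where
  "monom_degree m = (\<Sum>i \<in> Poly_Mapping.keys m. Poly_Mapping.lookup m i)"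

text \<open>Meaningful for nonzero polynomials only; the value at 0 is an unspecified \<^const>\<open>Max\<close>.\<close>

definition total_degree :: "'a::zero mpoly \<Rightarrow> nat" where
  "total_degree p = Max (monom_degree ` Poly_Mapping.keys p)"

text \<open>
  With d the total degree of a polynomial a in x_1, ..., x_n, expanding
  x_0^d * a(x_1/x_0, ..., x_n/x_0) turns each term c * x^m of a into
  c * x_0^(d - |m|) * x^m.  The subtraction does not truncate, since |m| \<le> d for the monomials of a.
  See \<open>eval_homogenize\<close> below for the defining formula itself.
\<close>

definition homogenize :: "'a::comm_monoid_add mpoly \<Rightarrow> 'a mpoly" where
  "homogenize p = (\<Sum>m \<in> Poly_Mapping.keys p.
     Poly_Mapping.single (Poly_Mapping.single 0 (total_degree p - monom_degree m) + m)
       (Poly_Mapping.lookup p m))"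

definition nonneg_poly :: "'a::{zero,ord} mpoly \<Rightarrow> bool" where
  "nonneg_poly p \<longleftrightarrow> (\<forall>m. 0 \<le> Poly_Mapping.lookup p m)"

text \<open>
  The minor of order k of an infinite matrix, with rows r 0 < ... < r (k-1) and
  columns c 0 < ... < c (k-1).
\<close>

definition matrix_minor ::
  "(nat \<Rightarrow> nat \<Rightarrow> 'b::comm_ring_1) \<Rightarrow> nat \<Rightarrow> (nat \<Rightarrow> nat) \<Rightarrow> (nat \<Rightarrow> nat) \<Rightarrow> 'b" where
  "matrix_minor A k r c = det (mat k k (\<lambda>(p, q). A (r p) (c q)))"

definition totally_positive :: "(nat \<Rightarrow> nat \<Rightarrow> 'a::linordered_idom mpoly) \<Rightarrow> bool" where
  "totally_positive A \<longleftrightarrow>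
     (\<forall>k r c. strict_mono_on {..<k} r \<longrightarrow> strict_mono_on {..<k} c \<longrightarrow>
        nonneg_poly (matrix_minor A k r c))"

definition hankel :: "(nat \<Rightarrow> 'b) \<Rightarrow> nat \<Rightarrow> nat \<Rightarrow> 'b" where
  "hankel a i j = a (i + j)"

definition stieltjes_moment_seq :: "nat set \<Rightarrow> (nat \<Rightarrow> 'a::linordered_idom mpoly) \<Rightarrow> bool" where
  "stieltjes_moment_seq V a \<longleftrightarrow> (\<forall>k. a k \<in> polys_in V) \<and> totally_positive (hankel a)"

definition eval_mpoly :: "(nat \<Rightarrow> 'a) \<Rightarrow> 'a::comm_semiring_1 mpoly \<Rightarrow> 'a" where
  "eval_mpoly f p = (\<Sum>m \<in> Poly_Mapping.keys p. Poly_Mapping.lookup p m *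
     (\<Prod>i \<in> Poly_Mapping.keys m. f i ^ Poly_Mapping.lookup m i))"

lemma eval_mpoly_sum:
  "finite A \<Longrightarrow> eval_mpoly f (\<Sum>x\<in>A. g x) = (\<Sum>x\<in>A. eval_mpoly f (g x))"
proof (induction A rule: finite_induct)
  case empty
  show ?case by (simp add: eval_mpoly_def)
next
  case (insert x A)
  have "eval_mpoly f (p + q) = eval_mpoly f p + eval_mpoly f q" for p q
    unfolding eval_mpoly_def
    by (rule setsum_keys_plus_distrib) (simp_all add: distrib_right)
  with insert show ?case by simp
qed

lemma eval_mpoly_single:
  "eval_mpoly f (Poly_Mapping.single m c) =
     c * (\<Prod>i \<in> Poly_Mapping.keys m. f i ^ Poly_Mapping.lookup m i)"
  by (cases "c = 0") (simp_all add: eval_mpoly_def)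

lemma eval_homogenize:
  fixes p :: "'a::field mpoly"
  assumes p: "p \<in> polys_in V" "0 \<notin> V" and f0: "f 0 \<noteq> 0"
  shows "eval_mpoly f (homogenize p) = f 0 ^ total_degree p * eval_mpoly (\<lambda>i. f i / f 0) p"
proof -
  have key: "(\<Prod>i \<in> Poly_Mapping.keys (Poly_Mapping.single 0 (total_degree p - monom_degree m) + m).
       f i ^ Poly_Mapping.lookup (Poly_Mapping.single 0 (total_degree p - monom_degree m) + m) i)
     = f 0 ^ total_degree p * (\<Prod>i \<in> Poly_Mapping.keys m. (f i / f 0) ^ Poly_Mapping.lookup m i)"
    if m: "m \<in> Poly_Mapping.keys p" for m
  proof -
    let ?e = "total_degree p - monom_degree m"
    let ?s = "Poly_Mapping.single 0 ?e + m"
    have z: "0 \<notin> Poly_Mapping.keys m" using p m by (auto simp: polys_in_def)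
    then have z': "Poly_Mapping.lookup m 0 = 0" by (simp add: in_keys_iff)
    have le: "monom_degree m \<le> total_degree p"
      unfolding total_degree_def using m by (intro Max_ge) auto
    have "(\<Prod>i \<in> Poly_Mapping.keys ?s. f i ^ Poly_Mapping.lookup ?s i)
        = (\<Prod>i \<in> insert 0 (Poly_Mapping.keys m). f i ^ Poly_Mapping.lookup ?s i)"
      using keys_add[of "Poly_Mapping.single 0 ?e" m]
      by (intro prod.mono_neutral_left) (auto simp: in_keys_iff split: if_splits)
    also have "\<dots> = f 0 ^ ?e * (\<Prod>i \<in> Poly_Mapping.keys m. f i ^ Poly_Mapping.lookup ?s i)"
      using z z' by (simp add: lookup_add)
    also have "(\<Prod>i \<in> Poly_Mapping.keys m. f i ^ Poly_Mapping.lookup ?s i)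
        = (\<Prod>i \<in> Poly_Mapping.keys m. f i ^ Poly_Mapping.lookup m i)"
      using z by (intro prod.cong refl) (auto simp: lookup_add lookup_single when_def)
    also have "\<dots> = f 0 ^ monom_degree m *
        (\<Prod>i \<in> Poly_Mapping.keys m. (f i / f 0) ^ Poly_Mapping.lookup m i)"
      using f0 by (simp add: monom_degree_def power_sum prod.distrib[symmetric] power_divide)
    finally show ?thesis
      using le by (simp add: mult.assoc[symmetric] power_add[symmetric])
  qed
  show ?thesis
    unfolding homogenize_def
    by (simp add: eval_mpoly_sum eval_mpoly_single key)
       (simp add: eval_mpoly_def sum_distrib_left mult.left_commute)
qed

end

theory Submission
  imports Defs
begin

text \<open>
  Homogenization to a prescribed degree bound is additive and is multiplicative when the bounds add.
  In every term of the expansion of a minor of the Hankel matrix the bounds add up to the same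
  number (the sum of all row and column indices), so a minor of the homogenized Hankel matrix is
  the homogenization of the original minor, and homogenization preserves the coefficients.
\<close>

text \<open>An upper bound instead of the exact degree: it survives cancellation in sums and holds
  vacuously for 0, where \<open>total_degree\<close> is unspecified.\<close>

definition degree_le :: "nat \<Rightarrow> 'a::zero mpoly \<Rightarrow> bool" where
  "degree_le d p \<longleftrightarrow> (\<forall>m \<in> Poly_Mapping.keys p. monom_degree m \<le> d)"

text \<open>\<open>homogenize\<close> is not additive, since cancellation can lower the degree; a
  target degree \<open>d\<close> independent of \<open>p\<close> repairs this. If \<open>p\<close>
  has degree above \<open>d\<close>, the subtraction truncates.\<close>

definition homogenize_to :: "nat \<Rightarrow> 'a::comm_monoid_add mpoly \<Rightarrow> 'a mpoly" where
  "homogenize_to d p = (\<Sum>m \<in> Poly_Mapping.keys p.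
     Poly_Mapping.single (Poly_Mapping.single 0 (d - monom_degree m) + m)
       (Poly_Mapping.lookup p m))"

lemma homogenize_eq_homogenize_to: "homogenize p = homogenize_to (total_degree p) p"
  by (simp add: homogenize_def homogenize_to_def)

lemma degree_le_total_degree: "degree_le (total_degree p) p"
  unfolding degree_le_def total_degree_def by (auto intro: Max_ge)

lemma monom_degree_add: "monom_degree (m + m') = monom_degree m + monom_degree m'"
  unfolding monom_degree_def by (rule setsum_keys_plus_distrib) simp_all

lemma degree_le_one: "degree_le 0 (1 :: 'a::comm_semiring_1 mpoly)"
  by (simp add: degree_le_def monom_degree_def)

lemma degree_le_mult:
  fixes p q :: "'a::comm_semiring_1 mpoly"
  assumes "degree_le d p" "degree_le e q"
  shows "degree_le (d + e) (p * q)"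
  unfolding degree_le_def
proof
  fix m assume "m \<in> Poly_Mapping.keys (p * q)"
  then obtain s t where "s \<in> Poly_Mapping.keys p" "t \<in> Poly_Mapping.keys q" "m = s + t"
    using keys_mult[of p q] by blast
  then show "monom_degree m \<le> d + e"
    using assms by (auto simp: degree_le_def monom_degree_add intro: add_mono)
qed

lemma degree_le_prod:
  fixes f :: "'b \<Rightarrow> 'a::comm_semiring_1 mpoly"
  assumes "finite A" "\<And>i. i \<in> A \<Longrightarrow> degree_le (d i) (f i)"
  shows "degree_le (\<Sum>i\<in>A. d i) (\<Prod>i\<in>A. f i)"
  using assms by (induction A rule: finite_induct) (auto simp: degree_le_one intro: degree_le_mult)

lemma homogenize_to_zero [simp]: "homogenize_to d 0 = 0"
  by (simp add: homogenize_to_def)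

lemma homogenize_to_single:
  "homogenize_to d (Poly_Mapping.single m c) =
     Poly_Mapping.single (Poly_Mapping.single 0 (d - monom_degree m) + m) c"
  by (cases "c = 0") (simp_all add: homogenize_to_def)

lemma homogenize_to_one: "homogenize_to 0 (1 :: 'a::comm_semiring_1 mpoly) = 1"
  by (simp add: homogenize_to_def)

text \<open>For fixed \<open>d\<close> the new monomial depends only on the old one, so the map is
  additive in the coefficients; terms that cancel contribute \<open>single _ 0 = 0\<close>.\<close>

lemma homogenize_to_add: "homogenize_to d (p + q) = homogenize_to d p + homogenize_to d q"
  unfolding homogenize_to_def
  by (rule setsum_keys_plus_distrib) (simp_all add: single_add)

lemma homogenize_to_sum:
  "homogenize_to d (\<Sum>x\<in>A. g x) = (\<Sum>x\<in>A. homogenize_to d (g x))"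
  by (induction A rule: infinite_finite_induct) (simp_all add: homogenize_to_add)

lemma homogenize_to_uminus:
  fixes p :: "'a::ab_group_add mpoly"
  shows "homogenize_to d (- p) = - homogenize_to d p"
  using homogenize_to_add[of d p "- p"] by (simp add: eq_neg_iff_add_eq_0 add.commute)

lemma sum_single_lookup:
  "(\<Sum>m \<in> Poly_Mapping.keys p. Poly_Mapping.single m (Poly_Mapping.lookup p m)) = p"
  by (rule poly_mapping_eqI)
    (simp add: lookup_sum lookup_single when_def in_keys_iff)

text \<open>Both sides are biadditive in the terms of \<open>p\<close> and \<open>q\<close>, so the
  claim reduces to single terms, where the exponents of variable 0 add up.\<close>

lemma homogenize_to_mult:
  fixes p q :: "'a::comm_semiring_1 mpoly"
  assumes "degree_le d p" "degree_le e q"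
  shows "homogenize_to (d + e) (p * q) = homogenize_to d p * homogenize_to e q"
proof -
  have "p * q = (\<Sum>s \<in> Poly_Mapping.keys p. Poly_Mapping.single s (Poly_Mapping.lookup p s)) *
      (\<Sum>t \<in> Poly_Mapping.keys q. Poly_Mapping.single t (Poly_Mapping.lookup q t))"
    by (simp add: sum_single_lookup)
  then have "p * q = (\<Sum>s \<in> Poly_Mapping.keys p. \<Sum>t \<in> Poly_Mapping.keys q.
      Poly_Mapping.single (s + t) (Poly_Mapping.lookup p s * Poly_Mapping.lookup q t))"
    by (simp add: sum_product mult_single)
  then have "homogenize_to (d + e) (p * q) =
      (\<Sum>s \<in> Poly_Mapping.keys p. \<Sum>t \<in> Poly_Mapping.keys q.
        Poly_Mapping.single (Poly_Mapping.single 0 (d + e - monom_degree (s + t)) + (s + t))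
          (Poly_Mapping.lookup p s * Poly_Mapping.lookup q t))"
    by (simp add: homogenize_to_sum homogenize_to_single)
  also have "\<dots> = (\<Sum>s \<in> Poly_Mapping.keys p. \<Sum>t \<in> Poly_Mapping.keys q.
      Poly_Mapping.single (Poly_Mapping.single 0 (d - monom_degree s) + s) (Poly_Mapping.lookup p s) *
      Poly_Mapping.single (Poly_Mapping.single 0 (e - monom_degree t) + t) (Poly_Mapping.lookup q t))"
  proof (intro sum.cong refl)
    fix s t assume "s \<in> Poly_Mapping.keys p" "t \<in> Poly_Mapping.keys q"
    then have "monom_degree s \<le> d" "monom_degree t \<le> e"
      using assms by (auto simp: degree_le_def)
    \<comment> \<open>The two degree bounds keep these natural-number subtractions from
      truncating.\<close>
    then have "d + e - monom_degree (s + t) = (d - monom_degree s) + (e - monom_degree t)"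
      by (simp add: monom_degree_add)
    then show "Poly_Mapping.single (Poly_Mapping.single 0 (d + e - monom_degree (s + t)) + (s + t))
          (Poly_Mapping.lookup p s * Poly_Mapping.lookup q t) =
        Poly_Mapping.single (Poly_Mapping.single 0 (d - monom_degree s) + s) (Poly_Mapping.lookup p s) *
        Poly_Mapping.single (Poly_Mapping.single 0 (e - monom_degree t) + t) (Poly_Mapping.lookup q t)"
      by (simp add: mult_single single_add ac_simps)
  qed
  also have "\<dots> = homogenize_to d p * homogenize_to e q"
    by (simp add: homogenize_to_def sum_product)
  finally show ?thesis .
qed

lemma homogenize_to_prod:
  fixes f :: "'b \<Rightarrow> 'a::comm_semiring_1 mpoly"
  assumes "finite A" "\<And>i. i \<in> A \<Longrightarrow> degree_le (d i) (f i)"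
  shows "homogenize_to (\<Sum>i\<in>A. d i) (\<Prod>i\<in>A. f i) = (\<Prod>i\<in>A. homogenize_to (d i) (f i))"
  using assms
  by (induction A rule: finite_induct)
    (simp_all add: homogenize_to_one homogenize_to_mult degree_le_prod)

text \<open>The degree bound splits into a row part and a column part, and every Leibniz term uses
  each chosen row and column once; hence all terms share one target degree and additivity
  applies.\<close>

lemma matrix_minor_homogenize_to:
  fixes A :: "nat \<Rightarrow> nat \<Rightarrow> 'a::comm_ring_1 mpoly"
  assumes "\<And>i j. degree_le (d i + e j) (A i j)"
  shows "matrix_minor (\<lambda>i j. homogenize_to (d i + e j) (A i j)) k r c =
    homogenize_to ((\<Sum>i<k. d (r i)) + (\<Sum>j<k. e (c j))) (matrix_minor A k r c)"
proof -
  let ?D = "(\<Sum>i<k. d (r i)) + (\<Sum>j<k. e (c j))"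
  have "signof \<pi> * (\<Prod>i=0..<k. homogenize_to (d (r i) + e (c (\<pi> i))) (A (r i) (c (\<pi> i)))) =
      homogenize_to ?D (signof \<pi> * (\<Prod>i=0..<k. A (r i) (c (\<pi> i))))"
    if \<pi>: "\<pi> permutes {0..<k}" for \<pi>
  proof -
    \<comment> \<open>Reindexing along \<open>\<pi>\<close> makes the column contribution
      independent of the permutation.\<close>
    have "(\<Sum>i=0..<k. e (c (\<pi> i))) = (\<Sum>j=0..<k. e (c j))"
      using sum.permute[OF \<pi>, of "\<lambda>j. e (c j)"] by (simp add: o_def)
    then have D: "?D = (\<Sum>i=0..<k. d (r i) + e (c (\<pi> i)))"
      by (simp add: sum.distrib atLeast0LessThan)
    have "homogenize_to ?D (\<Prod>i=0..<k. A (r i) (c (\<pi> i))) =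
        (\<Prod>i=0..<k. homogenize_to (d (r i) + e (c (\<pi> i))) (A (r i) (c (\<pi> i))))"
      unfolding D using assms by (intro homogenize_to_prod) auto
    then show ?thesis
      by (simp add: sign_def homogenize_to_uminus)
  qed
  \<comment> \<open>Lets the simplifier evaluate the \<open>mat k k\<close> entries at
    \<open>(i, \<pi> i)\<close>, which requires indices in range.\<close>
  moreover have "\<pi> i < k" if "\<pi> permutes {0..<k}" "i < k" for \<pi> i
    using permutes_in_image[OF that(1), of i] that(2) by simp
  ultimately show ?thesis
    by (simp add: matrix_minor_def det_def homogenize_to_sum)
qed

text \<open>Each coefficient of the result is a sum of coefficients of \<open>p\<close>, taken over
  the monomials sent to the same monomial.\<close>

lemma nonneg_poly_homogenize_to:
  fixes p :: "'a::ordered_comm_monoid_add mpoly"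
  assumes "nonneg_poly p"
  shows "nonneg_poly (homogenize_to d p)"
  using assms
  by (auto simp: nonneg_poly_def homogenize_to_def lookup_sum lookup_single when_def
      intro!: sum_nonneg)

lemma homogenize_to_in_polys_in:
  assumes "p \<in> polys_in V"
  shows "homogenize_to d p \<in> polys_in (insert 0 V)"
  unfolding polys_in_def
proof (intro CollectI ballI)
  fix m assume "m \<in> Poly_Mapping.keys (homogenize_to d p)"
  then obtain s where s: "s \<in> Poly_Mapping.keys p"
    and m: "m = Poly_Mapping.single 0 (d - monom_degree s) + s"
    unfolding homogenize_to_def
    by (auto dest!: subsetD[OF keys_sum] split: if_splits)
  have "Poly_Mapping.keys m \<subseteq> insert 0 (Poly_Mapping.keys s)"
    using keys_add[of "Poly_Mapping.single 0 (d - monom_degree s)" s]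
    by (auto simp: m split: if_splits)
  then show "Poly_Mapping.keys m \<subseteq> insert 0 V"
    using assms s by (auto simp: polys_in_def)
qed

theorem theorem2p5:
  fixes n :: nat and a :: "nat \<Rightarrow> 'a::linordered_idom mpoly"
  assumes "stieltjes_moment_seq {1..n} a"
    and "\<And>k. a k \<noteq> 0 \<and> total_degree (a k) = k"
  shows "stieltjes_moment_seq {0..n} (\<lambda>k. homogenize (a k))"
proof -
  have deg: "degree_le k (a k)" for k
    using degree_le_total_degree[of "a k"] assms(2) by simp
  \<comment> \<open>The exact degree \<open>k\<close> is what identifies the true homogenization
    with the one to the prescribed degree.\<close>
  have hom: "homogenize (a k) = homogenize_to k (a k)" for k
    using assms(2) by (simp add: homogenize_eq_homogenize_to)
  have "{0..n} = insert 0 {1..n}" by auto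
  then have "homogenize (a k) \<in> polys_in {0..n}" for k
    using assms(1) homogenize_to_in_polys_in[of "a k" "{1..n}"]
    by (simp add: hom stieltjes_moment_seq_def)
  moreover have "hankel (\<lambda>k. homogenize (a k)) =
      (\<lambda>i j. homogenize_to (i + j) (hankel a i j))"
    by (simp add: fun_eq_iff hankel_def hom)
  then have "matrix_minor (hankel (\<lambda>k. homogenize (a k))) k r c =
      homogenize_to ((\<Sum>i<k. r i) + (\<Sum>j<k. c j)) (matrix_minor (hankel a) k r c)" for k r c
    \<comment> \<open>The Hankel entry \<open>a (i + j)\<close> has degree \<open>i + j\<close>, so
      row \<open>i\<close> contributes \<open>i\<close> and column \<open>j\<close> contributes
      \<open>j\<close>.\<close>
    using matrix_minor_homogenize_to[of "\<lambda>i. i" "\<lambda>j. j" "hankel a"] deg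
    by (simp add: hankel_def)
  then have "totally_positive (hankel (\<lambda>k. homogenize (a k)))"
    using assms(1)
    by (simp add: stieltjes_moment_seq_def totally_positive_def nonneg_poly_homogenize_to)
  ultimately show ?thesis
    by (simp add: stieltjes_moment_seq_def)
qed

end
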